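(* Let $(M,\Sigma,\pi_1,\pi_2)$ be a CP monoid. Then there is a bijection $$\{(f,g)\in M^2\mid fg=1\}\leftrightarrow\{(\Phi,\tau_1,\tau_2)\mid (M,\Phi,\tau_1,\tau_2)\text{ is a CQP monoid}\}$$ that restricts to a bijection $$\{(u,u^{-1})\in M^2\mid u\in M^*\}\leftrightarrow\{(\Phi,\tau_1,\tau_2)\mid (M,\Phi,\tau_1,\tau_2)\text{ is a CP monoid}\}.$$
   Context: $M^*$ denotes the group of units (two-sided invertible elements) of the monoid $M$. A CQP (categorical quasiproduct) monoid $(M,\Sigma,\pi_1,\pi_2)$ is a monoid $M$ with elements $\pi_1,\pi_2\in M$ and a function $\Sigma:M^2\to M$ such that for all $a,b,c\in M$: $\pi_1\Sigma(a,b)=a$, $\pi_2\Sigma(a,b)=b$, and $\Sigma(ac,bc)=\Sigma(a,b)c$. A CP (categorical product) monoid $(M,\Sigma,\pi_1,\pi_2)$ is a monoid $M$ with elements $\pi_1,\pi_2\in M$ and a bijective function $\Sigma:M^2\to M$ such that $\pi_1\Sigma(a,b)=a$ and $\pi_2\Sigma(a,b)=b$ for all $a,b\in M$. In the sets of triples, the underlying monoid structure of $M$ is fixed, $\Phi$ is a function $M^2\to M$ and $\tau_1,\tau_2\in M$. *)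

theory Defs
  imports "HOL-Algebra.Group" "HOL-Library.FuncSet"
begin

locale CQP_monoid = monoid M for M (structure) +
  fixes \<Sigma> :: "'a \<times> 'a \<Rightarrow> 'a" and \<pi>\<^sub>1 \<pi>\<^sub>2 :: 'a
  assumes Sigma_funcset: "\<Sigma> \<in> carrier M \<times> carrier M \<rightarrow> carrier M"
    and pi1_closed: "\<pi>\<^sub>1 \<in> carrier M"
    and pi2_closed: "\<pi>\<^sub>2 \<in> carrier M"
    and pi1_Sigma: "\<lbrakk>a \<in> carrier M; b \<in> carrier M\<rbrakk> \<Longrightarrow> \<pi>\<^sub>1 \<otimes> \<Sigma> (a, b) = a"
    and pi2_Sigma: "\<lbrakk>a \<in> carrier M; b \<in> carrier M\<rbrakk> \<Longrightarrow> \<pi>\<^sub>2 \<otimes> \<Sigma> (a, b) = b"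
    and Sigma_mult: "\<lbrakk>a \<in> carrier M; b \<in> carrier M; c \<in> carrier M\<rbrakk>
      \<Longrightarrow> \<Sigma> (a \<otimes> c, b \<otimes> c) = \<Sigma> (a, b) \<otimes> c"

locale CP_monoid = monoid M for M (structure) +
  fixes \<Sigma> :: "'a \<times> 'a \<Rightarrow> 'a" and \<pi>\<^sub>1 \<pi>\<^sub>2 :: 'a
  assumes Sigma_bij: "bij_betw \<Sigma> (carrier M \<times> carrier M) (carrier M)"
    and pi1_closed: "\<pi>\<^sub>1 \<in> carrier M"
    and pi2_closed: "\<pi>\<^sub>2 \<in> carrier M"
    and pi1_Sigma: "\<lbrakk>a \<in> carrier M; b \<in> carrier M\<rbrakk> \<Longrightarrow> \<pi>\<^sub>1 \<otimes> \<Sigma> (a, b) = a"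
    and pi2_Sigma: "\<lbrakk>a \<in> carrier M; b \<in> carrier M\<rbrakk> \<Longrightarrow> \<pi>\<^sub>2 \<otimes> \<Sigma> (a, b) = b"

text \<open>In the sets of triples, a function on pairs of carrier elements is represented by its unique
  extensional representative, so that values outside the carrier do not produce distinct triples.\<close>

definition CQP_structures :: "('a, 'b) monoid_scheme \<Rightarrow> (('a \<times> 'a \<Rightarrow> 'a) \<times> 'a \<times> 'a) set" where
  "CQP_structures M = {(\<Phi>, \<tau>\<^sub>1, \<tau>\<^sub>2).
     \<Phi> \<in> extensional (carrier M \<times> carrier M) \<and> CQP_monoid M \<Phi> \<tau>\<^sub>1 \<tau>\<^sub>2}"

definition CP_structures :: "('a, 'b) monoid_scheme \<Rightarrow> (('a \<times> 'a \<Rightarrow> 'a) \<times> 'a \<times> 'a) set" where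
  "CP_structures M = {(\<Phi>, \<tau>\<^sub>1, \<tau>\<^sub>2).
     \<Phi> \<in> extensional (carrier M \<times> carrier M) \<and> CP_monoid M \<Phi> \<tau>\<^sub>1 \<tau>\<^sub>2}"

end

theory Submission imports Defs begin

text \<open>The given structure makes \<open>x \<mapsto> (\<pi>\<^sub>1 x, \<pi>\<^sub>2 x)\<close> an isomorphism of right \<open>M\<close>-sets from
  \<open>M\<close> to \<open>M \<times> M\<close>, with inverse \<open>\<Sigma>\<close>; equivariance of \<open>\<Sigma>\<close> is automatic because \<open>\<Sigma>\<close> inverts
  an equivariant map. A CQP structure \<open>(\<Phi>, \<tau>\<^sub>1, \<tau>\<^sub>2)\<close> amounts to equivariant maps
  \<open>\<Phi> : M \<times> M \<rightarrow> M\<close> and \<open>(\<tau>\<^sub>1, \<tau>\<^sub>2) : M \<rightarrow> M \<times> M\<close> whose composite on \<open>M \<times> M\<close> is the identity.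
  Transported along the isomorphism, these become equivariant endomaps of \<open>M\<close>, that is, left
  multiplications by some \<open>g\<close> and \<open>f\<close>, and the condition on the composite becomes \<open>f g = 1\<close>.

  Explicitly, \<open>(f, g)\<close> corresponds to \<open>\<Phi> = g \<Sigma>\<close>, \<open>\<tau>\<^sub>i = \<pi>\<^sub>i f\<close>, and evaluating at the
  universal elements gives the inverse \<open>f = \<Sigma>(\<tau>\<^sub>1, \<tau>\<^sub>2)\<close>, \<open>g = \<Phi>(\<pi>\<^sub>1, \<pi>\<^sub>2)\<close> (lemmas
  \<open>comparison_twist\<close> and \<open>twist_comparison\<close>). The equation \<open>f g = 1\<close> holds for this pair because
  \<open>\<Sigma>\<close> is a CP structure (\<open>comparison_section\<close>). If \<open>\<Phi>\<close> is a CP structure too, exchanging the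
  roles of the two structures gives \<open>g f = 1\<close>, so that \<open>f\<close> is a unit with inverse \<open>g\<close>; and
  conversely \<open>g \<Sigma>\<close> is bijective when \<open>g\<close> is a unit.\<close>

context CP_monoid
begin

lemma Sigma_closed: "\<lbrakk>a \<in> carrier M; b \<in> carrier M\<rbrakk> \<Longrightarrow> \<Sigma> (a, b) \<in> carrier M"
  using Sigma_bij by (auto simp: bij_betw_def)

text \<open>By surjectivity \<open>x = \<Sigma>(a, b)\<close>, and the projections recover \<open>a\<close> and \<open>b\<close>.\<close>

lemma Sigma_projections:
  assumes "x \<in> carrier M"
  shows "\<Sigma> (\<pi>\<^sub>1 \<otimes> x, \<pi>\<^sub>2 \<otimes> x) = x"
proof -
  obtain a b where "a \<in> carrier M" "b \<in> carrier M" "x = \<Sigma> (a, b)"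
    using assms Sigma_bij by (auto simp: bij_betw_def image_iff dest!: equalityD2 subsetD)
  then show ?thesis by (simp add: pi1_Sigma pi2_Sigma)
qed

lemma Sigma_pi: "\<Sigma> (\<pi>\<^sub>1, \<pi>\<^sub>2) = \<one>"
  using Sigma_projections[of \<one>] by (simp add: pi1_closed pi2_closed)

text \<open>An element is determined by its two projections, and those of \<open>\<Sigma>(a, b) c\<close> are \<open>a c\<close> and
  \<open>b c\<close>. Hence bijectivity already forces the third quasiproduct law.\<close>

lemma CQP: "CQP_monoid M \<Sigma> \<pi>\<^sub>1 \<pi>\<^sub>2"
proof (unfold_locales)
  fix a b c assume abc: "a \<in> carrier M" "b \<in> carrier M" "c \<in> carrier M"
  have "\<pi>\<^sub>1 \<otimes> (\<Sigma> (a, b) \<otimes> c) = a \<otimes> c" "\<pi>\<^sub>2 \<otimes> (\<Sigma> (a, b) \<otimes> c) = b \<otimes> c"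
    using abc by (simp_all add: m_assoc[symmetric] pi1_closed pi2_closed pi1_Sigma pi2_Sigma
        Sigma_closed)
  then show "\<Sigma> (a \<otimes> c, b \<otimes> c) = \<Sigma> (a, b) \<otimes> c"
    using Sigma_projections[of "\<Sigma> (a, b) \<otimes> c"] abc by (simp add: Sigma_closed)
qed (auto simp: Sigma_closed pi1_closed pi2_closed pi1_Sigma pi2_Sigma)

end

sublocale CP_monoid \<subseteq> CQP_monoid
  by (rule CQP)

lemma CP_structures_subset_CQP_structures: "CP_structures M \<subseteq> CQP_structures M"
  by (auto simp: CP_structures_def CQP_structures_def intro: CP_monoid.CQP)

text \<open>The element \<open>\<Sigma>(\<tau>\<^sub>1, \<tau>\<^sub>2)\<close> is the map into the product induced by the cone \<open>(\<tau>\<^sub>1, \<tau>\<^sub>2)\<close>, and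
  \<open>\<Phi>(\<pi>\<^sub>1, \<pi>\<^sub>2)\<close> is the map induced in the other direction. Their composite has the projections
  \<open>\<pi>\<^sub>1\<close> and \<open>\<pi>\<^sub>2\<close>, so it is the identity. This also yields the reverse composite when \<open>\<Phi>\<close> is a
  CP structure, as \<open>\<Sigma>\<close> may then be treated as the quasiproduct.\<close>

lemma (in CP_monoid) comparison_section:
  assumes "CQP_monoid M \<Phi> \<tau>\<^sub>1 \<tau>\<^sub>2"
  shows "\<Sigma> (\<tau>\<^sub>1, \<tau>\<^sub>2) \<otimes> \<Phi> (\<pi>\<^sub>1, \<pi>\<^sub>2) = \<one>"
proof -
  interpret Q: CQP_monoid M \<Phi> \<tau>\<^sub>1 \<tau>\<^sub>2 by fact
  have "\<Phi> (\<pi>\<^sub>1, \<pi>\<^sub>2) \<in> carrier M"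
    using Q.Sigma_funcset pi1_closed pi2_closed by auto
  then have "\<Sigma> (\<tau>\<^sub>1, \<tau>\<^sub>2) \<otimes> \<Phi> (\<pi>\<^sub>1, \<pi>\<^sub>2)
      = \<Sigma> (\<tau>\<^sub>1 \<otimes> \<Phi> (\<pi>\<^sub>1, \<pi>\<^sub>2), \<tau>\<^sub>2 \<otimes> \<Phi> (\<pi>\<^sub>1, \<pi>\<^sub>2))"
    by (simp add: Sigma_mult Q.pi1_closed Q.pi2_closed)
  also have "\<dots> = \<one>"
    by (simp add: Q.pi1_Sigma Q.pi2_Sigma pi1_closed pi2_closed Sigma_pi)
  finally show ?thesis .
qed

context CP_monoid
begin

definition twist :: "'a \<times> 'a \<Rightarrow> ('a \<times> 'a \<Rightarrow> 'a) \<times> 'a \<times> 'a" where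
  "twist = (\<lambda>(f, g). (restrict (\<lambda>p. g \<otimes> \<Sigma> p) (carrier M \<times> carrier M), \<pi>\<^sub>1 \<otimes> f, \<pi>\<^sub>2 \<otimes> f))"

definition comparison :: "('a \<times> 'a \<Rightarrow> 'a) \<times> 'a \<times> 'a \<Rightarrow> 'a \<times> 'a" where
  "comparison = (\<lambda>(\<Phi>, \<tau>\<^sub>1, \<tau>\<^sub>2). (\<Sigma> (\<tau>\<^sub>1, \<tau>\<^sub>2), \<Phi> (\<pi>\<^sub>1, \<pi>\<^sub>2)))"

text \<open>In \<open>\<pi>\<^sub>i f g \<Sigma>(a, b)\<close> the factor \<open>f g = 1\<close> cancels.\<close>

lemma twist_projections:
  assumes "f \<in> carrier M" "g \<in> carrier M" "f \<otimes> g = \<one>" "a \<in> carrier M" "b \<in> carrier M"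
  shows "(\<pi>\<^sub>1 \<otimes> f) \<otimes> (g \<otimes> \<Sigma> (a, b)) = a" "(\<pi>\<^sub>2 \<otimes> f) \<otimes> (g \<otimes> \<Sigma> (a, b)) = b"
proof -
  have cancel: "f \<otimes> (g \<otimes> \<Sigma> (a, b)) = \<Sigma> (a, b)"
    using assms by (simp add: m_assoc[symmetric] Sigma_closed)
  show "(\<pi>\<^sub>1 \<otimes> f) \<otimes> (g \<otimes> \<Sigma> (a, b)) = a" "(\<pi>\<^sub>2 \<otimes> f) \<otimes> (g \<otimes> \<Sigma> (a, b)) = b"
    using assms by (simp_all add: m_assoc cancel Sigma_closed pi1_closed pi2_closed
        pi1_Sigma pi2_Sigma)
qed

lemma twist_in_CQP_structures:
  assumes "f \<in> carrier M" "g \<in> carrier M" "f \<otimes> g = \<one>"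
  shows "twist (f, g) \<in> CQP_structures M"
proof -
  have "CQP_monoid M (restrict (\<lambda>p. g \<otimes> \<Sigma> p) (carrier M \<times> carrier M)) (\<pi>\<^sub>1 \<otimes> f) (\<pi>\<^sub>2 \<otimes> f)"
    using assms by unfold_locales
      (auto simp: twist_projections Sigma_closed Sigma_mult pi1_closed pi2_closed m_assoc[of g])
  then show ?thesis by (simp add: twist_def CQP_structures_def)
qed

lemma twist_unit_in_CP_structures:
  assumes "u \<in> Units M"
  shows "twist (u, inv u) \<in> CP_structures M"
proof -
  have u: "u \<in> carrier M" "inv u \<in> carrier M" "u \<otimes> inv u = \<one>"
    using assms by auto
  have "bij_betw (\<lambda>x. inv u \<otimes> x) (carrier M) (carrier M)"
    using assms by (intro bij_betwI[where g = "\<lambda>x. u \<otimes> x"])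
      (simp_all add: m_assoc[symmetric] Units_closed)
  then have "bij_betw ((\<lambda>x. inv u \<otimes> x) \<circ> \<Sigma>) (carrier M \<times> carrier M) (carrier M)"
    using Sigma_bij bij_betw_trans by blast
  then have "bij_betw (restrict (\<lambda>p. inv u \<otimes> \<Sigma> p) (carrier M \<times> carrier M))
      (carrier M \<times> carrier M) (carrier M)"
    by (simp cong: bij_betw_cong add: comp_def)
  then have "CP_monoid M (restrict (\<lambda>p. inv u \<otimes> \<Sigma> p) (carrier M \<times> carrier M))
      (\<pi>\<^sub>1 \<otimes> u) (\<pi>\<^sub>2 \<otimes> u)"
    using u by unfold_locales (auto simp: twist_projections pi1_closed pi2_closed)
  then show ?thesis by (simp add: twist_def CP_structures_def)
qed

lemma comparison_twist:
  assumes "f \<in> carrier M" "g \<in> carrier M"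
  shows "comparison (twist (f, g)) = (f, g)"
  using assms
  by (simp add: comparison_def twist_def Sigma_projections Sigma_pi pi1_closed pi2_closed)

text \<open>By equivariance, \<open>\<Phi>(\<pi>\<^sub>1, \<pi>\<^sub>2) \<Sigma>(a, b) = \<Phi>(\<pi>\<^sub>1 \<Sigma>(a, b), \<pi>\<^sub>2 \<Sigma>(a, b)) = \<Phi>(a, b)\<close>: a CQP
  structure is determined by its value at \<open>(\<pi>\<^sub>1, \<pi>\<^sub>2)\<close>.\<close>

lemma twist_comparison:
  assumes "T \<in> CQP_structures M"
  shows "twist (comparison T) = T"
proof -
  obtain \<Phi> \<tau>\<^sub>1 \<tau>\<^sub>2 where T: "T = (\<Phi>, \<tau>\<^sub>1, \<tau>\<^sub>2)" "\<Phi> \<in> extensional (carrier M \<times> carrier M)"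
      "CQP_monoid M \<Phi> \<tau>\<^sub>1 \<tau>\<^sub>2"
    using assms by (auto simp: CQP_structures_def)
  interpret Q: CQP_monoid M \<Phi> \<tau>\<^sub>1 \<tau>\<^sub>2 by fact
  have "\<Phi> (\<pi>\<^sub>1, \<pi>\<^sub>2) \<otimes> \<Sigma> (a, b) = \<Phi> (a, b)" if "a \<in> carrier M" "b \<in> carrier M" for a b
    using Q.Sigma_mult[of \<pi>\<^sub>1 \<pi>\<^sub>2 "\<Sigma> (a, b)"] that
    by (simp add: pi1_closed pi2_closed pi1_Sigma pi2_Sigma Sigma_closed)
  then have "restrict (\<lambda>p. \<Phi> (\<pi>\<^sub>1, \<pi>\<^sub>2) \<otimes> \<Sigma> p) (carrier M \<times> carrier M) = \<Phi>"
    using T(2) by (intro extensionalityI[OF restrict_extensional]) auto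
  then show ?thesis
    by (simp add: T(1) twist_def comparison_def pi1_Sigma pi2_Sigma Q.pi1_closed Q.pi2_closed)
qed

lemma comparison_of_CQP:
  assumes "T \<in> CQP_structures M"
  shows "comparison T \<in> {(f, g). f \<in> carrier M \<and> g \<in> carrier M \<and> f \<otimes> g = \<one>}"
proof -
  obtain \<Phi> \<tau>\<^sub>1 \<tau>\<^sub>2 where T: "T = (\<Phi>, \<tau>\<^sub>1, \<tau>\<^sub>2)" "CQP_monoid M \<Phi> \<tau>\<^sub>1 \<tau>\<^sub>2"
    using assms by (auto simp: CQP_structures_def)
  interpret Q: CQP_monoid M \<Phi> \<tau>\<^sub>1 \<tau>\<^sub>2 by fact
  show ?thesis
    using comparison_section[OF T(2)] Q.Sigma_funcset pi1_closed pi2_closed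
    by (auto simp: T(1) comparison_def Sigma_closed Q.pi1_closed Q.pi2_closed)
qed

lemma comparison_of_CP:
  assumes "T \<in> CP_structures M"
  shows "comparison T \<in> {(u, inv u) | u. u \<in> Units M}"
proof -
  obtain \<Phi> \<tau>\<^sub>1 \<tau>\<^sub>2 where T: "T = (\<Phi>, \<tau>\<^sub>1, \<tau>\<^sub>2)" "CP_monoid M \<Phi> \<tau>\<^sub>1 \<tau>\<^sub>2"
    using assms by (auto simp: CP_structures_def)
  define f g where "f = \<Sigma> (\<tau>\<^sub>1, \<tau>\<^sub>2)" and "g = \<Phi> (\<pi>\<^sub>1, \<pi>\<^sub>2)"
  have fg: "f \<in> carrier M" "g \<in> carrier M" "f \<otimes> g = \<one>"
    using comparison_of_CQP[of T] assms CP_structures_subset_CQP_structures[of M]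
    by (auto simp: T(1) comparison_def f_def g_def)
  have "g \<otimes> f = \<one>"
    unfolding f_def g_def by (rule CP_monoid.comparison_section[OF T(2) CQP])
  with fg have unit: "f \<in> Units M" unfolding Units_def by blast
  have "g = inv f"
    using \<open>g \<otimes> f = \<one>\<close> fg unit by (intro inv_unique[of g f]) simp_all
  with unit show ?thesis by (auto simp: T(1) comparison_def f_def g_def)
qed

end

theorem theorem5:
  fixes M (structure) and \<Sigma> :: "'a \<times> 'a \<Rightarrow> 'a" and \<pi>\<^sub>1 \<pi>\<^sub>2 :: 'a
  assumes "CP_monoid M \<Sigma> \<pi>\<^sub>1 \<pi>\<^sub>2"
  shows "\<exists>F.
    bij_betw F {(f, g). f \<in> carrier M \<and> g \<in> carrier M \<and> f \<otimes> g = \<one>} (CQP_structures M) \<and>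
    {(u, inv u) | u. u \<in> Units M} \<subseteq> {(f, g). f \<in> carrier M \<and> g \<in> carrier M \<and> f \<otimes> g = \<one>} \<and>
    bij_betw F {(u, inv u) | u. u \<in> Units M} (CP_structures M)"
proof -
  interpret CP_monoid M \<Sigma> \<pi>\<^sub>1 \<pi>\<^sub>2 by fact
  let ?P = "{(f, g). f \<in> carrier M \<and> g \<in> carrier M \<and> f \<otimes> g = \<one>}"
  let ?U = "{(u, inv u) | u. u \<in> Units M}"
  have sub: "?U \<subseteq> ?P" by auto
  have "bij_betw twist ?P (CQP_structures M)"
  proof (rule bij_betw_byWitness[where f' = comparison])
    show "\<forall>p\<in>?P. comparison (twist p) = p"
      by (auto simp: comparison_twist)
    show "\<forall>T\<in>CQP_structures M. twist (comparison T) = T"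
      using twist_comparison by blast
    show "twist ` ?P \<subseteq> CQP_structures M"
      by (auto simp: twist_in_CQP_structures)
    show "comparison ` CQP_structures M \<subseteq> ?P"
      by (rule image_subsetI) (rule comparison_of_CQP)
  qed
  moreover have "bij_betw twist ?U (CP_structures M)"
  proof (rule bij_betw_byWitness[where f' = comparison])
    show "\<forall>p\<in>?U. comparison (twist p) = p"
      by (auto simp: comparison_twist Units_closed)
    show "\<forall>T\<in>CP_structures M. twist (comparison T) = T"
      using CP_structures_subset_CQP_structures twist_comparison by blast
    show "twist ` ?U \<subseteq> CP_structures M"
      by (auto simp: twist_unit_in_CP_structures)
    show "comparison ` CP_structures M \<subseteq> ?U"
      by (rule image_subsetI) (rule comparison_of_CP)
  qed
  ultimately show ?thesis using sub by blast
qed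

end
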